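(* Let $a,b$ be odd positive integers and $n$ a positive integer. Then $$t(a,a,b,b;n)=N(a,a,b,b;4n+a+b)-N\big(a,a,b,b;2n+\tfrac{a+b}2\big).$$
   Context: For positive integers $a_1,\dots,a_k$ and a nonnegative integer $n$, $N(a_1,\dots,a_k;n)$ is the number of $(x_1,\dots,x_k)\in\mathbb Z^k$ with $n=a_1x_1^2+\cdots+a_kx_k^2$, and $t(a_1,\dots,a_k;n)$ is the number of $(x_1,\dots,x_k)\in\mathbb Z^k$ with $n=a_1\frac{x_1(x_1-1)}2+\cdots+a_k\frac{x_k(x_k-1)}2$. *)

theory Defs
  imports Main
begin

definition N_rep :: "nat list \<Rightarrow> nat \<Rightarrow> nat" where
  "N_rep as n = card {xs :: int list. length xs = length as \<and>
     int n = (\<Sum>i<length as. int (as ! i) * (xs ! i)\<^sup>2)}"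

(* The integer division is exact, since x * (x - 1) is always even. *)
definition t_rep :: "nat list \<Rightarrow> nat \<Rightarrow> nat" where
  "t_rep as n = card {xs :: int list. length xs = length as \<and>
     int n = (\<Sum>i<length as. int (as ! i) * ((xs ! i * (xs ! i - 1)) div 2))}"

end

theory Submission
  imports Defs
begin

text \<open>
  Put \<open>M = 4n + a + b\<close>, which is even. The rotation \<open>(x, y) \<mapsto> (x + y - 1, x - y)\<close> turns
  \<open>x(x - 1) + y(y - 1)\<close> into \<open>(u\<^sup>2 + v\<^sup>2 - 1) / 2\<close>, so \<open>t(a,a,b,b;n)\<close> counts the representations
  \<open>M = a(u\<^sup>2 + v\<^sup>2) + b(w\<^sup>2 + z\<^sup>2)\<close> with \<open>u + v\<close> and \<open>w + z\<close> odd. As \<open>a\<close>, \<open>b\<close> are odd and \<open>M\<close> is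
  even, \<open>u + v\<close> and \<open>w + z\<close> have the same parity in every representation of \<open>M\<close>. The
  representations with both even correspond under \<open>(p, q) \<mapsto> (p + q, p - q)\<close>, which doubles
  \<open>p\<^sup>2 + q\<^sup>2\<close>, to those of \<open>M / 2\<close>.
\<close>

text \<open>Passes from the list encoding of \<open>N_rep\<close> and \<open>t_rep\<close> to
  quadruples, on which the changes of variables below can be written by pattern matching.\<close>

lemma card_lists_length_4:
  "card {xs. length xs = 4 \<and> P (xs ! 0) (xs ! 1) (xs ! 2) (xs ! 3)} =
   card {(x, y, w, z). P x y w z}"
proof (rule bij_betw_same_card)
  show "bij_betw (\<lambda>xs. (xs ! 0, xs ! 1, xs ! 2, xs ! 3))
      {xs. length xs = 4 \<and> P (xs ! 0) (xs ! 1) (xs ! 2) (xs ! 3)} {(x, y, w, z). P x y w z}"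
    by (rule bij_betw_byWitness[where f' = "\<lambda>(x, y, w, z). [x, y, w, z]"])
      (auto simp: numeral_eq_Suc length_Suc_conv)
qed

definition quad_reps :: "int \<Rightarrow> int \<Rightarrow> int \<Rightarrow> (int \<times> int \<times> int \<times> int) set" where
  "quad_reps a b m = {(u, v, w, z). m = a * (u\<^sup>2 + v\<^sup>2) + b * (w\<^sup>2 + z\<^sup>2)}"

lemma N_rep_eq_card_quad_reps: "N_rep [a, a, b, b] m = card (quad_reps (int a) (int b) (int m))"
proof -
  have "N_rep [a, a, b, b] m = card {xs :: int list. length xs = 4 \<and>
      int m = int a * ((xs ! 0)\<^sup>2 + (xs ! 1)\<^sup>2) + int b * ((xs ! 2)\<^sup>2 + (xs ! 3)\<^sup>2)}"
    unfolding N_rep_def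
    by (intro arg_cong[where f = card] Collect_cong)
      (auto simp: numeral_eq_Suc algebra_simps)
  then show ?thesis
    using card_lists_length_4[of "\<lambda>u v w z. int m = int a * (u\<^sup>2 + v\<^sup>2) + int b * (w\<^sup>2 + z\<^sup>2)"]
    by (simp add: quad_reps_def)
qed

lemma t_rep_eq_card_quadruples:
  "t_rep [a, a, b, b] n = card {(x, y, w, z).
     2 * int n = int a * (x * (x - 1) + y * (y - 1)) + int b * (w * (w - 1) + z * (z - 1))}"
proof -
  have half: "x * (x - 1) = 2 * (x * (x - 1) div 2)" for x :: int
    by simp
  \<comment> \<open>Doubling clears the halves, so that only polynomial identities remain later; the
    exactness of \<open>div 2\<close> enters through \<open>half\<close> alone. The sum is nested to
    the right because the sum over the four indices unfolds to that shape.\<close>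
  have sum_iff: "int n = A * p + (A * q + (B * r + B * s)) \<longleftrightarrow>
      2 * int n = A * (p' + q') + B * (r' + s')"
    if "p' = 2 * p" "q' = 2 * q" "r' = 2 * r" "s' = 2 * s" for A B p q r s p' q' r' s' :: int
  proof -
    have eq: "A * (p' + q') + B * (r' + s') = 2 * (A * p + (A * q + (B * r + B * s)))"
      unfolding that by (simp add: algebra_simps)
    show ?thesis unfolding eq mult_cancel_left by simp
  qed
  have "t_rep [a, a, b, b] n = card {xs :: int list. length xs = 4 \<and>
      2 * int n = int a * (xs ! 0 * (xs ! 0 - 1) + xs ! 1 * (xs ! 1 - 1))
        + int b * (xs ! 2 * (xs ! 2 - 1) + xs ! 3 * (xs ! 3 - 1))}"
    unfolding t_rep_def
    by (subst sum_iff[OF half half half half, symmetric])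
      (simp add: numeral_eq_Suc add.assoc cong: conj_cong)
  then show ?thesis
    using card_lists_length_4[of "\<lambda>x y w z. 2 * int n =
        int a * (x * (x - 1) + y * (y - 1)) + int b * (w * (w - 1) + z * (z - 1))"]
    by simp
qed

text \<open>Positive integer coefficients are at least 1, so each square is at most
  \<open>m\<close>, and \<open>\<bar>x\<bar> \<le> x\<^sup>2\<close> holds for every integer.
  Finiteness makes \<open>card\<close> additive in the final count.\<close>

lemma finite_quad_reps:
  assumes "0 < a" and "0 < b"
  shows "finite (quad_reps a b m)"
proof (rule finite_subset)
  let ?I = "{- m..m}"
  show "finite (?I \<times> ?I \<times> ?I \<times> ?I)" by simp
  have bound: "x \<in> ?I" if "x\<^sup>2 \<le> m" for x :: int
  proof -
    have "\<bar>x\<bar> \<le> x\<^sup>2"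
      using self_le_power[of "\<bar>x\<bar>" 2] by (cases "x = 0") auto
    with that show ?thesis by auto
  qed
  have le: "s \<le> c * (s + t)" if "0 < c" "0 \<le> s" "0 \<le> t" for c s t :: int
    using that mult_right_mono[of 1 c "s + t"] by auto
  show "quad_reps a b m \<subseteq> ?I \<times> ?I \<times> ?I \<times> ?I"
  proof
    fix t
    assume "t \<in> quad_reps a b m"
    then obtain u v w z where t: "t = (u, v, w, z)"
      and m: "m = a * (u\<^sup>2 + v\<^sup>2) + b * (w\<^sup>2 + z\<^sup>2)"
      by (auto simp: quad_reps_def)
    have "0 \<le> a * (u\<^sup>2 + v\<^sup>2)" "0 \<le> b * (w\<^sup>2 + z\<^sup>2)" using assms by auto
    with m le[of a "u\<^sup>2" "v\<^sup>2"] le[of a "v\<^sup>2" "u\<^sup>2"] le[of b "w\<^sup>2" "z\<^sup>2"] le[of b "z\<^sup>2" "w\<^sup>2"] assms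
    have "u\<^sup>2 \<le> m" "v\<^sup>2 \<le> m" "w\<^sup>2 \<le> m" "z\<^sup>2 \<le> m"
      by (simp_all add: add.commute add_increasing add_increasing2)
    then show "t \<in> ?I \<times> ?I \<times> ?I \<times> ?I"
      unfolding t using bound by blast
  qed
qed

text \<open>Squaring preserves parity and \<open>a\<close>, \<open>b\<close> are odd, so
  \<open>m\<close> is congruent to \<open>(u + v) + (w + z)\<close> modulo 2.\<close>

lemma quad_reps_same_parity:
  assumes "odd a" and "odd b" and "even m" and "(u, v, w, z) \<in> quad_reps a b m"
  shows "even (u + v) \<longleftrightarrow> even (w + z)"
  using assms by (auto simp: quad_reps_def)

lemma card_quad_reps_even:
  "card {(u, v, w, z) \<in> quad_reps a b (2 * m). even (u + v) \<and> even (w + z)} =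
   card (quad_reps a b m)"
proof (rule sym, rule bij_betw_same_card)
  have double: "2 * m = a * ((p + q)\<^sup>2 + (p - q)\<^sup>2) + b * ((r + s)\<^sup>2 + (r - s)\<^sup>2) \<longleftrightarrow>
      m = a * (p\<^sup>2 + q\<^sup>2) + b * (r\<^sup>2 + s\<^sup>2)" for p q r s
  proof -
    have eq: "a * ((p + q)\<^sup>2 + (p - q)\<^sup>2) + b * ((r + s)\<^sup>2 + (r - s)\<^sup>2) =
        2 * (a * (p\<^sup>2 + q\<^sup>2) + b * (r\<^sup>2 + s\<^sup>2))"
      by (simp add: power2_eq_square algebra_simps)
    show ?thesis unfolding eq mult_cancel_left by simp
  qed
  \<comment> \<open>If \<open>u + v\<close> is even, so is \<open>u - v\<close>, and both halves are
    exact.\<close>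
  have split: "\<exists>p q. u = p + q \<and> v = p - q" if "even (u + v)" for u v :: int
    using that by (intro exI[of _ "(u + v) div 2"] exI[of _ "(u - v) div 2"]) (auto; presburger)
  show "bij_betw (\<lambda>(p, q, r, s). (p + q, p - q, r + s, r - s)) (quad_reps a b m)
      {(u, v, w, z) \<in> quad_reps a b (2 * m). even (u + v) \<and> even (w + z)}"
    unfolding bij_betw_def
  proof
    show "inj_on (\<lambda>(p, q, r, s). (p + q, p - q, r + s, r - s)) (quad_reps a b m)"
      by (auto simp: inj_on_def)
    show "(\<lambda>(p, q, r, s). (p + q, p - q, r + s, r - s)) ` quad_reps a b m =
        {(u, v, w, z) \<in> quad_reps a b (2 * m). even (u + v) \<and> even (w + z)}" (is "?f ` _ = ?R")
    proof
      show "?f ` quad_reps a b m \<subseteq> ?R"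
        by (auto simp: quad_reps_def double[symmetric])
      show "?R \<subseteq> ?f ` quad_reps a b m"
      proof clarify
        fix u v w z
        assume rep: "(u, v, w, z) \<in> quad_reps a b (2 * m)"
          and ev: "even (u + v)" "even (w + z)"
        obtain p q r s where eqs: "u = p + q" "v = p - q" "w = r + s" "z = r - s"
          using split[OF ev(1)] split[OF ev(2)] by blast
        with rep have "(p, q, r, s) \<in> quad_reps a b m"
          by (simp add: quad_reps_def double)
        then show "(u, v, w, z) \<in> ?f ` quad_reps a b m"
          by (rule rev_image_eqI) (simp add: eqs)
      qed
    qed
  qed
qed

lemma card_quad_reps_odd:
  "card {(u, v, w, z) \<in> quad_reps a b (4 * m + a + b). odd (u + v) \<and> odd (w + z)} =
   card {(x, y, w, z). 2 * m = a * (x * (x - 1) + y * (y - 1)) + b * (w * (w - 1) + z * (z - 1))}"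
proof (rule sym, rule bij_betw_same_card)
  let ?T = "{(x, y, w, z).
    2 * m = a * (x * (x - 1) + y * (y - 1)) + b * (w * (w - 1) + z * (z - 1))}"
  have double: "4 * m + a + b = a * ((x + y - 1)\<^sup>2 + (x - y)\<^sup>2) + b * ((w + z - 1)\<^sup>2 + (w - z)\<^sup>2) \<longleftrightarrow>
      2 * m = a * (x * (x - 1) + y * (y - 1)) + b * (w * (w - 1) + z * (z - 1))" for x y w z
  proof -
    \<comment> \<open>Each pair of squares leaves a constant 1 after expansion; these account for
      the shift by \<open>a + b\<close>.\<close>
    have "a * ((x + y - 1)\<^sup>2 + (x - y)\<^sup>2) + b * ((w + z - 1)\<^sup>2 + (w - z)\<^sup>2) =
        2 * (a * (x * (x - 1) + y * (y - 1)) + b * (w * (w - 1) + z * (z - 1))) + a + b"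
      by (simp add: power2_eq_square algebra_simps)
    moreover have "4 * m + a + b = 2 * k + a + b \<longleftrightarrow> 2 * m = k" for k
      by auto
    ultimately show ?thesis by (simp only:)
  qed
  \<comment> \<open>The witnesses solve \<open>u + v = 2 * x - 1\<close> and
    \<open>u - v = 2 * y - 1\<close>, whose left sides are both odd.\<close>
  have split: "\<exists>x y. u = x + y - 1 \<and> v = x - y" if "odd (u + v)" for u v :: int
    using that by (intro exI[of _ "(u + v + 1) div 2"] exI[of _ "(u - v + 1) div 2"]) (auto; presburger)
  show "bij_betw (\<lambda>(x, y, w, z). (x + y - 1, x - y, w + z - 1, w - z)) ?T
      {(u, v, w, z) \<in> quad_reps a b (4 * m + a + b). odd (u + v) \<and> odd (w + z)}"
    unfolding bij_betw_def
  proof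
    show "inj_on (\<lambda>(x, y, w, z). (x + y - 1, x - y, w + z - 1, w - z)) ?T"
      by (auto simp: inj_on_def)
    show "(\<lambda>(x, y, w, z). (x + y - 1, x - y, w + z - 1, w - z)) ` ?T =
        {(u, v, w, z) \<in> quad_reps a b (4 * m + a + b). odd (u + v) \<and> odd (w + z)}"
      (is "?f ` _ = ?R")
    proof
      show "?f ` ?T \<subseteq> ?R"
        by (auto simp: quad_reps_def double[symmetric])
      show "?R \<subseteq> ?f ` ?T"
      proof clarify
        fix u v w z
        assume rep: "(u, v, w, z) \<in> quad_reps a b (4 * m + a + b)"
          and od: "odd (u + v)" "odd (w + z)"
        obtain x y x' y' where eqs: "u = x + y - 1" "v = x - y" "w = x' + y' - 1" "z = x' - y'"
          using split[OF od(1)] split[OF od(2)] by blast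
        with rep have "(x, y, x', y') \<in> ?T"
          by (simp add: quad_reps_def double)
        then show "(u, v, w, z) \<in> ?f ` ?T"
          by (rule rev_image_eqI) (simp add: eqs)
      qed
    qed
  qed
qed

theorem theorem5p13:
  fixes a b n :: nat
  assumes "0 < a" and "odd a" and "0 < b" and "odd b" and "0 < n"
  shows "int (t_rep [a, a, b, b] n) =
    int (N_rep [a, a, b, b] (4 * n + a + b)) -
    int (N_rep [a, a, b, b] (2 * n + (a + b) div 2))"
proof -
  define M where "M = 4 * int n + int a + int b"
  define h where "h = int (2 * n + (a + b) div 2)"
  \<comment> \<open>The sum of the odd numbers \<open>a\<close> and \<open>b\<close> is even, so the
    \<open>div 2\<close> in \<open>h\<close> loses nothing.\<close>
  have M_eq: "M = 2 * h"
    using assms(2,4) unfolding M_def h_def by (auto elim!: oddE)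
  let ?Q = "quad_reps (int a) (int b) M"
  let ?E = "{(u, v, w, z) \<in> ?Q. even (u + v) \<and> even (w + z)}"
  let ?O = "{(u, v, w, z) \<in> ?Q. odd (u + v) \<and> odd (w + z)}"
  \<comment> \<open>Since \<open>M\<close> is even, the two mixed parity classes are empty.\<close>
  have "?Q = ?E \<union> ?O"
    using quad_reps_same_parity[of "int a" "int b" M] assms(2,4) M_eq by auto
  moreover have "finite ?Q"
    using assms(1,3) by (intro finite_quad_reps) auto
  moreover have "?E \<inter> ?O = {}" by auto
  ultimately have "card ?Q = card ?E + card ?O"
    by (metis (lifting) card_Un_disjoint finite_Un)
  moreover have "card ?Q = N_rep [a, a, b, b] (4 * n + a + b)"
    by (simp add: N_rep_eq_card_quad_reps M_def)
  moreover have "card ?E = N_rep [a, a, b, b] (2 * n + (a + b) div 2)"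
    unfolding M_eq card_quad_reps_even N_rep_eq_card_quad_reps h_def ..
  moreover have "card ?O = t_rep [a, a, b, b] n"
    unfolding M_def card_quad_reps_odd t_rep_eq_card_quadruples ..
  ultimately show ?thesis by simp
qed

end
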